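(* Let $F_0,k,b>0$, $T=\frac{4\pi}{b}$, and let $f:\mathbb{R}\to\mathbb{R}$ satisfy: (1) $f\in C^1(\mathbb{R})$; (2) $f(z)\to 0$ as $|z|\to\infty$; (3) $f'(z)\to 0$ as $|z|\to\infty$; (4) whenever $(z_n)$, $(v_n)$ are real sequences with $|z_n|\to\infty$, $|v_n|\to\infty$, $\frac{v_n}{z_n}\to 1$ as $n\to\infty$, and $f'(z_n)\neq 0$ for all $n$, one has $$\frac{f^2(v_n)}{f'(z_n)}\to 0,\qquad \frac{(f'(v_n))^2}{f'(z_n)}\to 0;$$ (5) the equation $z'=F_z(t,z)$ has no fixed points. Then there exists a constant $D>0$ such that every solution $z:[0,T]\to\mathbb{R}$ of the boundary-value problem $$z'(t)=F_z(t,z(t)),\ t\in[0,T],\qquad z(0)-z(T)=0,$$ satisfies $\|z\|_C\le D$.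
   Context: For constants $F_0,k,b>0$ and a function $f$, define $V(t,z)=F_0 f(z)\left(\cos\left(kz-\frac{bt}{2}\right)\right)^2$ and $F_z(t,z)=\frac{\partial V}{\partial z}(t,z)$, i.e. $$F_z(t,z)=-kF_0 f(z)\sin(2kz-bt)+F_0\left(\cos\left(kz-\frac{bt}{2}\right)\right)^2 f'(z).$$ A fixed point of $z'=F_z(t,z)$ is a real number $\overline z$ with $F_z(t,\overline z)=0$ for all $t$ (i.e. a constant solution). The norm is $\|z\|_C=\max_{t\in[0,T]}|z(t)|$ on $C([0,T],\mathbb{R})$. *)

theory Defs
  imports "HOL-Analysis.Analysis"
begin

definition V :: "real \<Rightarrow> real \<Rightarrow> real \<Rightarrow> (real \<Rightarrow> real) \<Rightarrow> real \<Rightarrow> real \<Rightarrow> real" where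
  "V F0 k b f t z = F0 * f z * (cos (k * z - b * t / 2))\<^sup>2"

definition F_z :: "real \<Rightarrow> real \<Rightarrow> real \<Rightarrow> (real \<Rightarrow> real) \<Rightarrow> real \<Rightarrow> real \<Rightarrow> real" where
  "F_z F0 k b f t z = deriv (\<lambda>x. V F0 k b f t x) z"

lemma F_z_eq:
  assumes "f field_differentiable (at z)"
  shows "F_z F0 k b f t z =
           - k * F0 * f z * sin (2 * k * z - b * t)
           + F0 * (cos (k * z - b * t / 2))\<^sup>2 * deriv f z"
proof -
  have f': "(f has_real_derivative deriv f z) (at z)"
    using assms by (simp add: DERIV_deriv_iff_field_differentiable)
  have arg: "2 * k * z - b * t = 2 * (k * z - b * t / 2)"
    by simp
  have "((\<lambda>x. V F0 k b f t x) has_real_derivative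
           - k * F0 * f z * sin (2 * k * z - b * t)
           + F0 * (cos (k * z - b * t / 2))\<^sup>2 * deriv f z) (at z)"
    unfolding V_def arg sin_double
    by (rule derivative_eq_intros f' refl | simp add: algebra_simps power2_eq_square)+
  then show ?thesis
    unfolding F_z_def by (rule DERIV_imp_deriv)
qed

definition fixed_point :: "(real \<Rightarrow> real \<Rightarrow> real) \<Rightarrow> real \<Rightarrow> bool" where
  "fixed_point G c \<longleftrightarrow> (\<forall>t. G t c = 0)"

text \<open>
  Functions on \<open>[0, T]\<close> are represented by total functions whose values outside the
  interval are irrelevant; at the endpoints the derivative is one-sided.
\<close>

definition periodic_solution :: "(real \<Rightarrow> real \<Rightarrow> real) \<Rightarrow> real \<Rightarrow> (real \<Rightarrow> real) \<Rightarrow> bool" where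
  "periodic_solution G T z \<longleftrightarrow>
     (\<forall>t\<in>{0..T}. (z has_real_derivative G t (z t)) (at t within {0..T})) \<and>
     z 0 - z T = 0"

definition C_norm :: "real \<Rightarrow> (real \<Rightarrow> real) \<Rightarrow> real" where
  "C_norm T z = (SUP t\<in>{0..T}. \<bar>z t\<bar>)"

text \<open>For continuous \<open>z\<close> the supremum is a maximum.\<close>

lemma C_norm_attained:
  assumes "0 \<le> T" "continuous_on {0..T} z"
  shows "\<exists>s\<in>{0..T}. C_norm T z = \<bar>z s\<bar> \<and> (\<forall>t\<in>{0..T}. \<bar>z t\<bar> \<le> \<bar>z s\<bar>)"
proof -
  have "continuous_on {0..T} (\<lambda>t. \<bar>z t\<bar>)"
    using assms(2) by (intro continuous_intros)
  then obtain s where s: "s \<in> {0..T}" "\<forall>t\<in>{0..T}. \<bar>z t\<bar> \<le> \<bar>z s\<bar>"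
    using continuous_attains_sup[of "{0..T}" "\<lambda>t. \<bar>z t\<bar>"] assms(1) by auto
  have "C_norm T z = \<bar>z s\<bar>"
    unfolding C_norm_def using s by (intro cSup_eq_maximum) auto
  with s show ?thesis by blast
qed

end

theory Submission
  imports Defs
begin

text \<open>
  The idea is to average the equation over \<open>[0, T]\<close>. While \<open>z\<close> stays near a constant \<open>c\<close>,
  the term with \<open>sin (2 * k * c - b * t)\<close> averages to zero, whereas \<open>(cos (k * c - b * t / 2))\<^sup>2\<close>
  averages to \<open>1 / 2\<close>. Periodicity therefore forces a weighted average of \<open>deriv f (z t)\<close> to be as
  small as the error made in replacing \<open>z t\<close> by \<open>c\<close>. The speed of \<open>z\<close>, and hence its oscillation, is
  linear in the sizes of \<open>f\<close> and \<open>deriv f\<close> along the orbit, so this error is quadratic in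
  them. This gives \<open>periodic_solution_averaging_estimate\<close>: along the orbit of any periodic solution,
  some value of \<open>deriv f\<close> is bounded by a constant times squares of values of \<open>f\<close> and \<open>deriv f\<close>.

  The growth condition on sequences says the opposite for orbits far from the origin: by
  \<open>squares_negligible_far_out\<close>, the squares of \<open>f\<close> and \<open>deriv f\<close> at nearby points are negligible
  against \<open>deriv f x\<close>, provided that \<open>deriv f x \<noteq> 0\<close>. As \<open>f\<close> and \<open>deriv f\<close> are bounded, all orbits
  have uniformly bounded oscillation, so a large orbit is far from the origin as a whole and
  the two statements contradict each other, unless \<open>deriv f\<close> vanishes somewhere on the orbit.

  That last case is excluded by \<open>deriv_nonzero_far_out\<close>, which is where the absence of fixed points
  enters: a common zero of \<open>f\<close> and \<open>deriv f\<close> would be one. Hence at a zero of \<open>deriv f\<close> the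
  square of \<open>f\<close> is positive, while \<open>deriv f\<close> takes arbitrarily small nonzero values close to a
  suitable zero; far out, this violates the growth condition.
\<close>

section \<open>The growth condition far from the origin\<close>

text \<open>
  Points at bounded distance from each other that escape to infinity have ratio tending to one,
  so the sequential condition applies to them and turns into a uniform estimate.
\<close>

lemma squares_negligible_far_out:
  fixes f g :: "real \<Rightarrow> real" and r e :: real
  assumes growth: "\<And>x v :: nat \<Rightarrow> real.
      \<lbrakk>filterlim (\<lambda>n. \<bar>x n\<bar>) at_top sequentially;
       filterlim (\<lambda>n. \<bar>v n\<bar>) at_top sequentially;
       (\<lambda>n. v n / x n) \<longlonglongrightarrow> 1;
       \<And>n. g (x n) \<noteq> 0\<rbrakk>
      \<Longrightarrow> (\<lambda>n. (f (v n))\<^sup>2 / g (x n)) \<longlonglongrightarrow> 0 \<and> (\<lambda>n. (g (v n))\<^sup>2 / g (x n)) \<longlonglongrightarrow> 0"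
    and "e > 0"
  shows "\<exists>R>0. \<forall>x v. \<bar>x\<bar> \<ge> R \<longrightarrow> \<bar>v - x\<bar> \<le> r \<longrightarrow> g x \<noteq> 0
           \<longrightarrow> (f v)\<^sup>2 \<le> e * \<bar>g x\<bar> \<and> (g v)\<^sup>2 \<le> e * \<bar>g x\<bar>"
proof (rule ccontr)
  assume contra: "\<not> ?thesis"
  have "\<exists>x v. \<bar>x\<bar> \<ge> real (Suc n) \<and> \<bar>v - x\<bar> \<le> r \<and> g x \<noteq> 0
          \<and> \<not> ((f v)\<^sup>2 \<le> e * \<bar>g x\<bar> \<and> (g v)\<^sup>2 \<le> e * \<bar>g x\<bar>)" for n
  proof -
    have "real (Suc n) > 0" by simp
    with contra show ?thesis by blast
  qed
  then obtain x v where x: "\<And>n. \<bar>x n\<bar> \<ge> real (Suc n)" and v: "\<And>n. \<bar>v n - x n\<bar> \<le> r"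
    and gx: "\<And>n. g (x n) \<noteq> 0"
    and bad: "\<And>n. \<not> ((f (v n))\<^sup>2 \<le> e * \<bar>g (x n)\<bar> \<and> (g (v n))\<^sup>2 \<le> e * \<bar>g (x n)\<bar>)"
    by metis
  have x': "\<bar>x n\<bar> > real n" for n
    using x[of n] by simp
  have real_lim: "filterlim (\<lambda>n. real n) at_top sequentially"
    by (rule filterlim_real_sequentially)
  have x_lim: "filterlim (\<lambda>n. \<bar>x n\<bar>) at_top sequentially"
  proof (rule filterlim_at_top_mono[OF real_lim])
    show "\<forall>\<^sub>F n in sequentially. real n \<le> \<bar>x n\<bar>"
      using x' by (simp add: less_imp_le)
  qed
  have v_lim: "filterlim (\<lambda>n. \<bar>v n\<bar>) at_top sequentially"
  proof (rule filterlim_at_top_mono)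
    show "filterlim (\<lambda>n. - r + real n) at_top sequentially"
      by (rule filterlim_tendsto_add_at_top[OF tendsto_const real_lim])
    show "\<forall>\<^sub>F n in sequentially. - r + real n \<le> \<bar>v n\<bar>"
    proof (intro always_eventually allI)
      fix n
      show "- r + real n \<le> \<bar>v n\<bar>"
        using x'[of n] v[of n] by linarith
    qed
  qed
  have "(\<lambda>n. (v n - x n) / x n) \<longlonglongrightarrow> 0"
  proof (rule Lim_null_comparison)
    show "\<forall>\<^sub>F n in sequentially. norm ((v n - x n) / x n) \<le> r / \<bar>x n\<bar>"
      using v by (intro always_eventually allI) (simp add: abs_divide divide_right_mono)
    show "(\<lambda>n. r / \<bar>x n\<bar>) \<longlonglongrightarrow> 0"
      by (rule tendsto_divide_0[OF tendsto_const filterlim_at_top_imp_at_infinity[OF x_lim]])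
  qed
  then have "(\<lambda>n. 1 + (v n - x n) / x n) \<longlonglongrightarrow> 1 + 0"
    by (intro tendsto_intros)
  moreover have "1 + (v n - x n) / x n = v n / x n" for n
    using x'[of n] by (auto simp: diff_divide_distrib)
  ultimately have ratio: "(\<lambda>n. v n / x n) \<longlonglongrightarrow> 1"
    by simp
  have small: "\<forall>\<^sub>F n in sequentially. (h (v n))\<^sup>2 \<le> e * \<bar>g (x n)\<bar>"
    if "(\<lambda>n. (h (v n))\<^sup>2 / g (x n)) \<longlonglongrightarrow> 0" for h :: "real \<Rightarrow> real"
  proof -
    from tendstoD[OF that \<open>e > 0\<close>]
    have "\<forall>\<^sub>F n in sequentially. (h (v n))\<^sup>2 / \<bar>g (x n)\<bar> < e"
      by (simp add: dist_real_def abs_divide)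
    then show ?thesis
      by eventually_elim (use gx in \<open>simp add: pos_divide_less_eq less_imp_le\<close>)
  qed
  have "\<forall>\<^sub>F n in sequentially. (f (v n))\<^sup>2 \<le> e * \<bar>g (x n)\<bar> \<and> (g (v n))\<^sup>2 \<le> e * \<bar>g (x n)\<bar>"
    using growth[OF x_lim v_lim ratio gx] small[of f] small[of g]
    by (simp add: eventually_conj)
  with bad show False
    by (auto simp: eventually_sequentially)
qed

text \<open>
  Moving away from the origin, starting at a zero of the derivative \<open>g\<close>, one meets a point with
  \<open>g \<noteq> 0\<close>: otherwise \<open>f\<close> would be constant from there to infinity, hence zero, and would vanish
  together with its derivative. Let \<open>s * u\<close> be the last zero of \<open>g\<close> before that point. Just beyond
  it, \<open>g\<close> is nonzero and, by continuity, smaller than \<open>(f (s * u))\<^sup>2 > 0\<close>. The sign \<open>s\<close> selects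
  one of the two directions.
\<close>

lemma small_nonzero_deriv_beyond_zero:
  fixes f g :: "real \<Rightarrow> real" and a s :: real
  assumes f': "\<And>x. (f has_real_derivative g x) (at x)"
    and g_cont: "continuous_on UNIV g"
    and f_lim: "(f \<longlongrightarrow> 0) at_infinity"
    and no_common_zero: "\<And>x. \<not> (f x = 0 \<and> g x = 0)"
    and s: "\<bar>s\<bar> = 1"
    and zero: "g (s * a) = 0"
  obtains u y where "a \<le> u" "u < y" "y \<le> u + 1"
    "g (s * y) \<noteq> 0" "\<bar>g (s * y)\<bar> < (f (s * u))\<^sup>2"
proof -
  have gs_cont: "continuous_on UNIV (\<lambda>x. g (s * x))"
    by (intro continuous_on_compose2[OF g_cont] continuous_intros) auto
  have fs': "((\<lambda>x. f (s * x)) has_real_derivative g (s * x) * s) (at x)" for x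
    by (rule DERIV_chain2[OF f']) (auto intro!: derivative_eq_intros)
  have "\<exists>x>a. g (s * x) \<noteq> 0"
  proof (rule ccontr)
    assume "\<not> ?thesis"
    with zero have flat: "g (s * x) = 0" if "x \<ge> a" for x
      using that by (metis order_le_less)
    have const: "f (s * x) = f (s * a)" if "x \<ge> a" for x
    proof (cases "x = a")
      case False
      with that have "a < x" by simp
      moreover have "continuous_on {a..x} (\<lambda>x. f (s * x))"
        by (rule DERIV_continuous_on) (rule has_field_derivative_at_within[OF fs'])
      moreover have "((\<lambda>x. f (s * x)) has_real_derivative 0) (at w)" if "a < w" "w < x" for w
        using fs'[of w] flat[of w] that by simp
      ultimately show ?thesis
        by (rule DERIV_isconst_end)
    qed simp
    have "filterlim (\<lambda>x. s * x) at_infinity at_top"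
      using s by (intro tendsto_mult_filterlim_at_infinity[OF tendsto_const]
        filterlim_at_top_imp_at_infinity filterlim_ident) auto
    then have "((\<lambda>x. f (s * x)) \<longlongrightarrow> 0) at_top"
      by (rule filterlim_compose[OF f_lim])
    moreover have "((\<lambda>x. f (s * x)) \<longlongrightarrow> f (s * a)) at_top"
      by (rule tendsto_eventually, rule eventually_mono[OF eventually_ge_at_top[of a] const])
    ultimately have "f (s * a) = 0"
      by (rule tendsto_unique[OF trivial_limit_at_top_linorder, symmetric])
    with no_common_zero zero show False by blast
  qed
  then obtain x where x: "x > a" "g (s * x) \<noteq> 0" by blast
  define S where "S = {u \<in> {a..x}. g (s * u) = 0}"
  have "S = {a..x} \<inter> (\<lambda>u. g (s * u)) -` {0}"
    by (auto simp: S_def)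
  moreover have "closed ({a..x} \<inter> (\<lambda>u. g (s * u)) -` {0})"
    by (intro continuous_closed_preimage continuous_on_subset[OF gs_cont]) auto
  ultimately have "compact S"
    by (metis compact_Icc compact_Int_closed inf.left_idem)
  moreover have "a \<in> S"
    using zero x by (simp add: S_def)
  ultimately obtain u where u: "u \<in> S" and last: "\<And>w. w \<in> S \<Longrightarrow> w \<le> u"
    using compact_attains_sup[of S] by blast
  have gu: "g (s * u) = 0" and "a \<le> u" "u < x"
    using u x by (auto simp: S_def order_le_less)
  have "isCont (\<lambda>x. g (s * x)) u"
    using gs_cont continuous_on_eq_continuous_at by blast
  moreover have "(f (s * u))\<^sup>2 > 0"
    using no_common_zero[of "s * u"] gu by simp
  ultimately obtain d where "d > 0"
    and d: "\<And>w. dist w u < d \<Longrightarrow> dist (g (s * w)) (g (s * u)) < (f (s * u))\<^sup>2"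
    unfolding continuous_at_eps_delta by blast
  define y where "y = u + min (min (d / 2) 1) (x - u)"
  have y: "u < y" "y \<le> u + 1" "y \<le> x" "dist y u < d"
    using \<open>d > 0\<close> \<open>u < x\<close> by (auto simp: y_def dist_real_def)
  have "g (s * y) \<noteq> 0"
    using last[of y] y \<open>a \<le> u\<close> by (auto simp: S_def)
  moreover have "\<bar>g (s * y)\<bar> < (f (s * u))\<^sup>2"
    using d[OF y(4)] gu by (simp add: dist_real_def)
  ultimately show thesis
    using that \<open>a \<le> u\<close> y by blast
qed

text \<open>
  Beyond a zero of \<open>g\<close>, \<open>small_nonzero_deriv_beyond_zero\<close> provides points at distance at most one
  at which \<open>f\<^sup>2\<close> exceeds a nonzero value of \<open>\<bar>g\<bar>\<close>, contrary to the smallness of \<open>f\<^sup>2\<close> far out.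
\<close>

lemma deriv_nonzero_far_out:
  fixes f g :: "real \<Rightarrow> real"
  assumes f': "\<And>x. (f has_real_derivative g x) (at x)"
    and g_cont: "continuous_on UNIV g"
    and f_lim: "(f \<longlongrightarrow> 0) at_infinity"
    and no_common_zero: "\<And>x. \<not> (f x = 0 \<and> g x = 0)"
    and negligible: "\<And>x v. \<lbrakk>\<bar>x\<bar> \<ge> R; \<bar>v - x\<bar> \<le> 1; g x \<noteq> 0\<rbrakk> \<Longrightarrow> (f v)\<^sup>2 \<le> \<bar>g x\<bar>"
    and "\<bar>x\<bar> \<ge> R"
  shows "g x \<noteq> 0"
proof
  assume "g x = 0"
  define s :: real where "s = (if x \<ge> 0 then 1 else - 1)"
  have s: "\<bar>s\<bar> = 1" and x: "x = s * \<bar>x\<bar>"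
    by (auto simp: s_def)
  have "g (s * \<bar>x\<bar>) = 0"
    using \<open>g x = 0\<close> x by simp
  then obtain u y where uy: "\<bar>x\<bar> \<le> u" "u < y" "y \<le> u + 1"
    "g (s * y) \<noteq> 0" "\<bar>g (s * y)\<bar> < (f (s * u))\<^sup>2"
    using small_nonzero_deriv_beyond_zero[OF f' g_cont f_lim no_common_zero s] by blast
  have "\<bar>s * y\<bar> \<ge> R" "\<bar>s * u - s * y\<bar> \<le> 1"
    using uy \<open>\<bar>x\<bar> \<ge> R\<close> by (auto simp: s_def)
  with negligible uy show False
    by (meson not_le)
qed

section \<open>The averaging estimate for periodic solutions\<close>

lemma periodic_solution_deriv:
  assumes "periodic_solution G T z" "t \<in> {0..T}"
  shows "(z has_real_derivative G t (z t)) (at t within {0..T})"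
  using assms by (simp add: periodic_solution_def)

lemma periodic_solution_continuous:
  assumes "periodic_solution G T z"
  shows "continuous_on {0..T} z"
  by (rule DERIV_continuous_on) (rule periodic_solution_deriv[OF assms])

lemma oscillation_le:
  fixes h h' :: "real \<Rightarrow> real"
  assumes "\<And>t. t \<in> {0..T} \<Longrightarrow> (h has_real_derivative h' t) (at t within {0..T})"
    and "\<And>t. t \<in> {0..T} \<Longrightarrow> \<bar>h' t\<bar> \<le> L"
    and "r \<in> {0..T}" "t \<in> {0..T}"
  shows "\<bar>h t - h r\<bar> \<le> T * L"
proof -
  have "\<bar>h t - h r\<bar> \<le> L * \<bar>t - r\<bar>"
    using field_differentiable_bound[of "{0..T}" h h' L t r] assms by (simp add: convex_real_interval)
  also have "\<dots> \<le> L * T"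
  proof (rule mult_left_mono)
    show "\<bar>t - r\<bar> \<le> T" using assms(3,4) by auto
    show "0 \<le> L" using assms(2)[OF assms(3)] by linarith
  qed
  finally show ?thesis by (simp add: mult.commute)
qed

lemma abs_sin_diff_le: "\<bar>sin x - sin y\<bar> \<le> \<bar>x - y\<bar>" for x y :: real
  using field_differentiable_bound[of UNIV sin cos 1 x y] DERIV_sin abs_cos_le_one by simp

lemma abs_cos_squared_diff_le: "\<bar>(cos x)\<^sup>2 - (cos y)\<^sup>2\<bar> \<le> \<bar>x - y\<bar>" for x y :: real
proof -
  have "((\<lambda>x. (cos x)\<^sup>2) has_real_derivative - sin (2 * x)) (at x)" for x :: real
    by (auto intro!: derivative_eq_intros simp: sin_double)
  then show ?thesis
    using field_differentiable_bound[of UNIV "\<lambda>x. (cos x)\<^sup>2" "\<lambda>x. - sin (2 * x)" 1 x y] by simp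
qed

lemma abs_F_z_le:
  assumes "f field_differentiable (at x)" "F0 > 0" "k > 0" "\<bar>f x\<bar> \<le> A" "\<bar>deriv f x\<bar> \<le> B"
  shows "\<bar>F_z F0 k b f t x\<bar> \<le> F0 * (k * A + B)"
proof -
  have A: "\<bar>f x * sin (2 * k * x - b * t)\<bar> \<le> A * 1"
    unfolding abs_mult using assms by (intro mult_mono) auto
  have "\<bar>(cos (k * x - b * t / 2))\<^sup>2\<bar> \<le> 1"
    by (simp add: abs_square_le_1)
  then have B: "\<bar>(cos (k * x - b * t / 2))\<^sup>2 * deriv f x\<bar> \<le> 1 * B"
    unfolding abs_mult using assms by (intro mult_mono) auto
  have "F_z F0 k b f t x = F0 * ((cos (k * x - b * t / 2))\<^sup>2 * deriv f x
          - k * (f x * sin (2 * k * x - b * t)))"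
    by (simp add: F_z_eq[OF assms(1)] algebra_simps)
  also have "\<bar>\<dots>\<bar> \<le> F0 * (B + k * A)"
  proof -
    have "k * \<bar>f x * sin (2 * k * x - b * t)\<bar> \<le> k * A"
      using A \<open>k > 0\<close> by simp
    with B have "\<bar>(cos (k * x - b * t / 2))\<^sup>2 * deriv f x - k * (f x * sin (2 * k * x - b * t))\<bar>
        \<le> B + k * A"
      using \<open>k > 0\<close> abs_mult[of k "f x * sin (2 * k * x - b * t)"] by linarith
    then show ?thesis
      using \<open>F0 > 0\<close> by (simp add: abs_mult)
  qed
  finally show ?thesis by (simp add: add.commute)
qed

text \<open>
  The points \<open>p\<close> and \<open>q\<close> maximise \<open>\<bar>f\<bar>\<close> and \<open>\<bar>deriv f\<bar>\<close> along the orbit. If \<open>deriv f\<close> has a zero on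
  the orbit, this zero serves as \<open>z r\<close>; otherwise \<open>deriv f\<close> has constant sign there, and \<open>r\<close>
  minimises \<open>\<bar>deriv f\<bar>\<close>. The constant sign prevents cancellation in the average of \<open>deriv f\<close>
  with weight \<open>(cos (k * c - b * t / 2))\<^sup>2\<close>, so the minimum is controlled by that average. Instead of
  integrating, one applies the mean value theorem to \<open>z\<close> corrected by explicit antiderivatives.
\<close>

lemma periodic_solution_averaging_estimate:
  fixes f :: "real \<Rightarrow> real"
  assumes pos: "F0 > 0" "k > 0" "b > 0" and T: "T = 4 * pi / b"
    and f_diff: "\<And>x. f field_differentiable (at x)"
    and f'_cont: "continuous_on UNIV (deriv f)"
    and z: "periodic_solution (F_z F0 k b f) T z"
  obtains r p q where "r \<in> {0..T}" "p \<in> {0..T}" "q \<in> {0..T}"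
    "\<bar>deriv f (z r)\<bar> \<le> 8 * F0 * k * T * (k\<^sup>2 * (f (z p))\<^sup>2 + (deriv f (z q))\<^sup>2)"
proof -
  have "T > 0" using pos T by simp
  then have nonempty: "{0..T} \<noteq> {}" and zero_in: "0 \<in> {0..T}" by auto
  have z_cont: "continuous_on {0..T} z"
    by (rule periodic_solution_continuous[OF z])
  have f_cont: "continuous_on UNIV f"
    by (simp add: continuous_at_imp_continuous_on f_diff field_differentiable_imp_continuous_at)
  have fz_cont: "continuous_on {0..T} (\<lambda>t. f (z t))"
    and f'z_cont: "continuous_on {0..T} (\<lambda>t. deriv f (z t))"
    by (auto intro: continuous_on_compose2[OF f_cont z_cont] continuous_on_compose2[OF f'_cont z_cont])
  obtain p where p: "p \<in> {0..T}" "\<And>t. t \<in> {0..T} \<Longrightarrow> \<bar>f (z t)\<bar> \<le> \<bar>f (z p)\<bar>"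
    using continuous_attains_sup[OF compact_Icc nonempty continuous_on_rabs[OF fz_cont]] by blast
  obtain q where q: "q \<in> {0..T}" "\<And>t. t \<in> {0..T} \<Longrightarrow> \<bar>deriv f (z t)\<bar> \<le> \<bar>deriv f (z q)\<bar>"
    using continuous_attains_sup[OF compact_Icc nonempty continuous_on_rabs[OF f'z_cont]] by blast
  define A B L c where "A = \<bar>f (z p)\<bar>" and "B = \<bar>deriv f (z q)\<bar>"
    and "L = F0 * (k * A + B)" and "c = z 0"
  note A = p(2)[folded A_def] and B = q(2)[folded B_def]
  have nonneg: "A \<ge> 0" "B \<ge> 0" "L \<ge> 0"
    using pos by (auto simp: A_def B_def L_def)

  have speed: "\<bar>F_z F0 k b f t (z t)\<bar> \<le> L" if "t \<in> {0..T}" for t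
    unfolding L_def using abs_F_z_le[OF f_diff pos(1,2) A[OF that] B[OF that]] .
  have z_osc: "\<bar>z t - c\<bar> \<le> T * L" if "t \<in> {0..T}" for t
    unfolding c_def using oscillation_le[OF periodic_solution_deriv[OF z] speed zero_in that] .
  have fz_osc: "\<bar>f (z t) - f c\<bar> \<le> T * (B * L)" if "t \<in> {0..T}" for t
    unfolding c_def
  proof (rule oscillation_le[OF _ _ zero_in that])
    fix t assume t: "t \<in> {0..T}"
    have "(f has_real_derivative deriv f (z t)) (at (z t))"
      using f_diff by (simp add: DERIV_deriv_iff_field_differentiable)
    then show "((\<lambda>t. f (z t)) has_real_derivative deriv f (z t) * F_z F0 k b f t (z t))
        (at t within {0..T})"
      by (rule DERIV_chain2) (rule periodic_solution_deriv[OF z t])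
    show "\<bar>deriv f (z t) * F_z F0 k b f t (z t)\<bar> \<le> B * L"
      unfolding abs_mult using speed[OF t] B[OF t] nonneg by (intro mult_mono) auto
  qed

  define w where "w t = (cos (k * c - b * t / 2))\<^sup>2" for t
  define err where "err t = F_z F0 k b f t (z t) + k * F0 * f c * sin (2 * k * c - b * t)
    - F0 * w t * deriv f (z t)" for t
  define E where "E = 2 * F0\<^sup>2 * k * T * (k * A + B)\<^sup>2"
  have err: "\<bar>err t\<bar> \<le> E" if t: "t \<in> {0..T}" for t
  proof -
    define d1 d2 d3 where "d1 = (f (z t) - f c) * sin (2 * k * z t - b * t)"
      and "d2 = f c * (sin (2 * k * z t - b * t) - sin (2 * k * c - b * t))"
      and "d3 = ((cos (k * z t - b * t / 2))\<^sup>2 - w t) * deriv f (z t)"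
    have "\<bar>d1\<bar> \<le> T * (B * L) * 1"
      unfolding d1_def abs_mult using fz_osc[OF t] nonneg \<open>T > 0\<close> by (intro mult_mono) auto
    then have d1: "k * \<bar>d1\<bar> \<le> k * (T * (B * L))"
      using pos by simp
    have "\<bar>sin (2 * k * z t - b * t) - sin (2 * k * c - b * t)\<bar> \<le> 2 * k * \<bar>z t - c\<bar>"
      using abs_sin_diff_le[of "2 * k * z t - b * t" "2 * k * c - b * t"] pos
      by (simp add: abs_mult flip: right_diff_distrib)
    also have "\<dots> \<le> 2 * k * (T * L)"
      using z_osc[OF t] pos by simp
    finally have "\<bar>d2\<bar> \<le> A * (2 * k * (T * L))"
      unfolding d2_def abs_mult using A[OF zero_in] nonneg by (intro mult_mono) (auto simp: c_def)
    then have d2: "k * \<bar>d2\<bar> \<le> k * (A * (2 * k * (T * L)))"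
      using pos by simp
    have "\<bar>(cos (k * z t - b * t / 2))\<^sup>2 - w t\<bar> \<le> k * \<bar>z t - c\<bar>"
      unfolding w_def using abs_cos_squared_diff_le[of "k * z t - b * t / 2" "k * c - b * t / 2"] pos
      by (simp add: abs_mult flip: right_diff_distrib)
    also have "\<dots> \<le> k * (T * L)"
      using z_osc[OF t] pos by simp
    finally have d3: "\<bar>d3\<bar> \<le> k * (T * L) * B"
      unfolding d3_def abs_mult using B[OF t] nonneg pos \<open>T > 0\<close> by (intro mult_mono) auto
    have "err t = F0 * (d3 - k * d1 - k * d2)"
      by (simp add: err_def d1_def d2_def d3_def F_z_eq[OF f_diff] algebra_simps)
    then have "\<bar>err t\<bar> = F0 * \<bar>d3 - k * d1 - k * d2\<bar>"
      using pos by (simp add: abs_mult)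
    also have "\<dots> \<le> F0 * (\<bar>d3\<bar> + k * \<bar>d1\<bar> + k * \<bar>d2\<bar>)"
    proof (rule mult_left_mono)
      have "\<bar>k * d1\<bar> = k * \<bar>d1\<bar>" "\<bar>k * d2\<bar> = k * \<bar>d2\<bar>"
        using pos by (auto simp: abs_mult)
      then show "\<bar>d3 - k * d1 - k * d2\<bar> \<le> \<bar>d3\<bar> + k * \<bar>d1\<bar> + k * \<bar>d2\<bar>"
        by linarith
    qed (use pos in simp)
    also have "\<dots> \<le> F0 * (k * (T * L) * B + k * (T * (B * L)) + k * (A * (2 * k * (T * L))))"
      using d1 d2 d3 pos by (intro mult_left_mono add_mono) auto
    also have "\<dots> = E"
      by (simp add: E_def L_def power2_eq_square algebra_simps)
    finally show ?thesis .
  qed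

  \<comment> \<open>The added terms are antiderivatives of \<open>sin (2 * k * c - b * t)\<close> and of \<open>w\<close>. They change by \<open>0\<close>
    and \<open>T / 2\<close> over \<open>[0, T]\<close>, where \<open>2 * k * c - b * t\<close> runs through two full periods.\<close>
  define Q where "Q m t = z t + k * F0 * f c * (cos (2 * k * c - b * t) / b)
    - F0 * m * (t / 2 - sin (2 * k * c - b * t) / (2 * b))" for m t
  have bT: "b * T = 4 * pi"
    using T pos by simp
  have periods: "sin (x - b * T) = sin x" "cos (x - b * T) = cos x" for x
    unfolding bT by (simp_all add: sin_diff cos_diff)
  have Q_change: "Q m T - Q m 0 = - F0 * m * T / 2" for m
    using z unfolding Q_def periods by (simp add: periodic_solution_def algebra_simps)
  have Q_deriv: "(Q m has_real_derivative err t + F0 * w t * (deriv f (z t) - m)) (at t within {0..T})"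
    if "t \<in> {0..T}" for m t
  proof -
    have "w t = 1 / 2 + cos (2 * k * c - b * t) / 2"
      unfolding w_def using cos_double_cos[of "k * c - b * t / 2"]
      by (simp add: algebra_simps)
    then have "F_z F0 k b f t (z t) + k * F0 * f c * (- (sin (2 * k * c - b * t) * - b) / b)
        - F0 * m * (1 / 2 - cos (2 * k * c - b * t) * - b / (2 * b))
        = err t + F0 * w t * (deriv f (z t) - m)"
      using pos by (simp add: err_def field_simps)
    moreover have "(Q m has_real_derivative F_z F0 k b f t (z t)
        + k * F0 * f c * (- (sin (2 * k * c - b * t) * - b) / b)
        - F0 * m * (1 / 2 - cos (2 * k * c - b * t) * - b / (2 * b))) (at t within {0..T})"
      unfolding Q_def using pos
      by (auto intro!: derivative_eq_intros periodic_solution_deriv[OF z that])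
    ultimately show ?thesis by simp
  qed
  have Q_mvt: "\<exists>t\<in>{0..T}. - F0 * m / 2 = err t + F0 * w t * (deriv f (z t) - m)" for m
  proof -
    obtain t where t: "t \<in> {0<..<T}"
      "Q m T - Q m 0 = (err t + F0 * w t * (deriv f (z t) - m)) * (T - 0)"
      using mvt_simple[OF \<open>T > 0\<close>, of "Q m" "\<lambda>t h. (err t + F0 * w t * (deriv f (z t) - m)) * h"]
        Q_deriv[unfolded has_field_derivative_def] by fastforce
    then have "- F0 * m / 2 * T = (err t + F0 * w t * (deriv f (z t) - m)) * T"
      unfolding Q_change by simp
    then have "- F0 * m / 2 = err t + F0 * w t * (deriv f (z t) - m)"
      using \<open>T > 0\<close> by (metis less_irrefl mult_right_cancel)
    with t show ?thesis by (intro bexI[of _ t]) auto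
  qed
  have w_nonneg: "0 \<le> F0 * w t" for t
    using pos by (simp add: w_def)
  obtain lo where lo: "lo \<in> {0..T}" "\<And>t. t \<in> {0..T} \<Longrightarrow> deriv f (z lo) \<le> deriv f (z t)"
    using continuous_attains_inf[OF compact_Icc nonempty f'z_cont] by blast
  obtain hi where hi: "hi \<in> {0..T}" "\<And>t. t \<in> {0..T} \<Longrightarrow> deriv f (z t) \<le> deriv f (z hi)"
    using continuous_attains_sup[OF compact_Icc nonempty f'z_cont] by blast
  have "E \<ge> 0"
    using pos \<open>T > 0\<close> by (simp add: E_def)
  have "\<exists>r\<in>{0..T}. F0 * \<bar>deriv f (z r)\<bar> \<le> 2 * E"
  proof -
    consider "deriv f (z lo) > 0" | "deriv f (z hi) < 0"
      | "deriv f (z lo) \<le> 0" "0 \<le> deriv f (z hi)" by linarith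
    then show ?thesis
    proof cases
      case 1
      obtain t where t: "t \<in> {0..T}"
        "- F0 * deriv f (z lo) / 2 = err t + F0 * w t * (deriv f (z t) - deriv f (z lo))"
        using Q_mvt by blast
      have "0 \<le> F0 * w t * (deriv f (z t) - deriv f (z lo))"
        using lo(2)[OF t(1)] by (intro mult_nonneg_nonneg[OF w_nonneg]) simp
      with t err[OF t(1)] have "F0 * deriv f (z lo) \<le> 2 * E" by linarith
      with 1 lo show ?thesis by (intro bexI[of _ lo]) auto
    next
      case 2
      obtain t where t: "t \<in> {0..T}"
        "- F0 * deriv f (z hi) / 2 = err t + F0 * w t * (deriv f (z t) - deriv f (z hi))"
        using Q_mvt by blast
      have "F0 * w t * (deriv f (z t) - deriv f (z hi)) \<le> 0"
        using hi(2)[OF t(1)] by (intro mult_nonneg_nonpos[OF w_nonneg]) simp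
      with t err[OF t(1)] have "F0 * - deriv f (z hi) \<le> 2 * E" by linarith
      with 2 hi show ?thesis by (intro bexI[of _ hi]) auto
    next
      case 3
      have "connected ((\<lambda>t. deriv f (z t)) ` {0..T})"
        by (rule connected_continuous_image[OF f'z_cont]) simp
      then have "0 \<in> (\<lambda>t. deriv f (z t)) ` {0..T}"
        using 3 lo(1) hi(1) by (meson connectedD_interval imageI)
      then obtain r where "r \<in> {0..T}" "deriv f (z r) = 0" by auto
      then show ?thesis
        using \<open>E \<ge> 0\<close> by (intro bexI[of _ r]) simp_all
    qed
  qed
  then obtain r where r: "r \<in> {0..T}" and "F0 * \<bar>deriv f (z r)\<bar> \<le> 2 * E" by blast
  then have "F0 * \<bar>deriv f (z r)\<bar> \<le> F0 * (4 * F0 * k * T * (k * A + B)\<^sup>2)"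
    by (simp add: E_def power2_eq_square algebra_simps)
  then have "\<bar>deriv f (z r)\<bar> \<le> 4 * F0 * k * T * (k * A + B)\<^sup>2"
    using pos by simp
  also have "\<dots> \<le> 4 * F0 * k * T * (2 * (k\<^sup>2 * A\<^sup>2 + B\<^sup>2))"
  proof (rule mult_left_mono)
    have "0 \<le> (k * A - B)\<^sup>2" by simp
    then show "(k * A + B)\<^sup>2 \<le> 2 * (k\<^sup>2 * A\<^sup>2 + B\<^sup>2)"
      by (simp add: power2_eq_square algebra_simps)
  qed (use pos \<open>T > 0\<close> in simp)
  finally have "\<bar>deriv f (z r)\<bar> \<le> 8 * F0 * k * T * (k\<^sup>2 * (f (z p))\<^sup>2 + (deriv f (z q))\<^sup>2)"
    by (simp add: A_def B_def algebra_simps)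
  with r p q that show thesis by blast
qed

section \<open>The a priori bound\<close>

lemma bounded_if_tendsto_at_infinity:
  fixes g :: "real \<Rightarrow> real"
  assumes "continuous_on UNIV g" "(g \<longlongrightarrow> l) at_infinity"
  obtains M where "\<And>x. \<bar>g x\<bar> \<le> M"
proof -
  obtain R where R: "\<And>x. norm x \<ge> R \<Longrightarrow> dist (g x) l < 1"
    using tendstoD[OF assms(2), of 1] by (auto simp: eventually_at_infinity)
  have "bounded (g ` cball 0 R)"
    by (intro compact_imp_bounded compact_continuous_image continuous_on_subset[OF assms(1)]) auto
  then obtain N where N: "\<And>x. x \<in> cball 0 R \<Longrightarrow> norm (g x) \<le> N"
    unfolding bounded_iff by blast
  have "\<bar>g x\<bar> \<le> max N (\<bar>l\<bar> + 1)" for x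
    using R[of x] N[of x] by (cases "norm x \<ge> R") (auto simp: dist_real_def)
  then show thesis using that by blast
qed

theorem theorem1:
  fixes F0 k b T :: real and f :: "real \<Rightarrow> real"
  assumes "F0 > 0" and "k > 0" and "b > 0" and "T = 4 * pi / b"
    and "f C1_differentiable_on UNIV"
    and "(f \<longlongrightarrow> 0) at_infinity"
    and "(deriv f \<longlongrightarrow> 0) at_infinity"
    and "\<And>z v :: nat \<Rightarrow> real.
           \<lbrakk>filterlim (\<lambda>n. \<bar>z n\<bar>) at_top sequentially;
            filterlim (\<lambda>n. \<bar>v n\<bar>) at_top sequentially;
            (\<lambda>n. v n / z n) \<longlonglongrightarrow> 1;
            \<And>n. deriv f (z n) \<noteq> 0\<rbrakk>
           \<Longrightarrow> (\<lambda>n. (f (v n))\<^sup>2 / deriv f (z n)) \<longlonglongrightarrow> 0 \<and>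
               (\<lambda>n. (deriv f (v n))\<^sup>2 / deriv f (z n)) \<longlonglongrightarrow> 0"
    and "\<not> (\<exists>c. fixed_point (F_z F0 k b f) c)"
  shows "\<exists>D>0. \<forall>z. periodic_solution (F_z F0 k b f) T z \<longrightarrow> C_norm T z \<le> D"
proof -
  note pos = assms(1-3) and growth = assms(8)
  have "T > 0" using assms(3,4) by simp
  obtain g where g: "\<And>x. (f has_real_derivative g x) (at x)" and g_cont: "continuous_on UNIV g"
    using assms(5) by (auto simp: C1_differentiable_on_def has_real_derivative_iff_has_vector_derivative)
  then have "deriv f = g"
    by (auto intro: DERIV_imp_deriv)
  with g g_cont have f': "\<And>x. (f has_real_derivative deriv f x) (at x)"
    and f'_cont: "continuous_on UNIV (deriv f)" by auto
  then have f_diff: "\<And>x. f field_differentiable (at x)"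
    by (auto simp: field_differentiable_def)
  have f_cont: "continuous_on UNIV f"
    by (simp add: continuous_at_imp_continuous_on f_diff field_differentiable_imp_continuous_at)
  have no_common_zero: "\<not> (f x = 0 \<and> deriv f x = 0)" for x
    using assms(9) unfolding fixed_point_def F_z_eq[OF f_diff]
    by (metis add_0 mult_zero_left mult_zero_right)

  obtain A where A: "\<And>x. \<bar>f x\<bar> \<le> A"
    using bounded_if_tendsto_at_infinity[OF f_cont assms(6)] by blast
  obtain B where B: "\<And>x. \<bar>deriv f x\<bar> \<le> B"
    using bounded_if_tendsto_at_infinity[OF f'_cont assms(7)] by blast
  define r where "r = T * (F0 * (k * A + B))"
  have osc: "\<bar>z t - z s\<bar> \<le> r"
    if "periodic_solution (F_z F0 k b f) T z" "s \<in> {0..T}" "t \<in> {0..T}" for z s t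
    unfolding r_def
    using oscillation_le[OF periodic_solution_deriv[OF that(1)] abs_F_z_le[OF f_diff pos(1,2) A B] that(2,3)] .

  \<comment> \<open>With this \<open>e\<close>, the averaging estimate on a far away orbit gives \<open>\<bar>deriv f x\<bar> \<le> \<bar>deriv f x\<bar> / 2\<close>.\<close>
  define K where "K = 8 * F0 * k * T"
  define e where "e = 1 / (2 * K * (k\<^sup>2 + 1))"
  have "K > 0"
    using pos \<open>T > 0\<close> by (simp add: K_def)
  have k1: "k\<^sup>2 + 1 > 0"
    by (simp add: add_nonneg_pos)
  with \<open>K > 0\<close> have "e > 0" and Ke: "K * (k\<^sup>2 + 1) * e = 1 / 2"
    by (auto simp: e_def)
  have negligible: "\<exists>R>0. \<forall>x v. \<bar>x\<bar> \<ge> R \<longrightarrow> \<bar>v - x\<bar> \<le> \<rho> \<longrightarrow> deriv f x \<noteq> 0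
      \<longrightarrow> (f v)\<^sup>2 \<le> \<epsilon> * \<bar>deriv f x\<bar> \<and> (deriv f v)\<^sup>2 \<le> \<epsilon> * \<bar>deriv f x\<bar>"
    if "\<epsilon> > 0" for \<epsilon> \<rho>
    by (rule squares_negligible_far_out[OF _ that]) (fact growth)
  obtain R1 where R1: "\<And>x v. \<lbrakk>\<bar>x\<bar> \<ge> R1; \<bar>v - x\<bar> \<le> 1; deriv f x \<noteq> 0\<rbrakk> \<Longrightarrow> (f v)\<^sup>2 \<le> \<bar>deriv f x\<bar>"
    using negligible[OF zero_less_one, of 1] unfolding mult_1 by blast
  obtain R2 where "R2 > 0" and R2: "\<And>x v. \<lbrakk>\<bar>x\<bar> \<ge> R2; \<bar>v - x\<bar> \<le> r; deriv f x \<noteq> 0\<rbrakk>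
      \<Longrightarrow> (f v)\<^sup>2 \<le> e * \<bar>deriv f x\<bar> \<and> (deriv f v)\<^sup>2 \<le> e * \<bar>deriv f x\<bar>"
    using negligible[OF \<open>e > 0\<close>, of r] by blast
  define D where "D = max R1 R2 + \<bar>r\<bar>"
  have "C_norm T z \<le> D" if z: "periodic_solution (F_z F0 k b f) T z" for z
    unfolding C_norm_def
  proof (rule cSUP_least)
    show "{0..T} \<noteq> {}" using \<open>T > 0\<close> by simp
    fix t assume t: "t \<in> {0..T}"
    show "\<bar>z t\<bar> \<le> D"
    proof (rule ccontr)
      assume large: "\<not> \<bar>z t\<bar> \<le> D"
      obtain s p q where s: "s \<in> {0..T}" and p: "p \<in> {0..T}" and q: "q \<in> {0..T}"
        and avg: "\<bar>deriv f (z s)\<bar> \<le> K * (k\<^sup>2 * (f (z p))\<^sup>2 + (deriv f (z q))\<^sup>2)"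
        unfolding K_def
        using periodic_solution_averaging_estimate[OF pos assms(4) f_diff f'_cont z] by blast
      have "\<bar>z s\<bar> \<ge> max R1 R2"
        using large osc[OF z s t] unfolding D_def by linarith
      then have far: "\<bar>z s\<bar> \<ge> R1" "\<bar>z s\<bar> \<ge> R2" by auto
      have nz: "deriv f (z s) \<noteq> 0"
        by (rule deriv_nonzero_far_out[OF f' f'_cont assms(6) no_common_zero R1 far(1)])
      have "(f (z p))\<^sup>2 \<le> e * \<bar>deriv f (z s)\<bar>" "(deriv f (z q))\<^sup>2 \<le> e * \<bar>deriv f (z s)\<bar>"
        using R2[OF far(2) osc[OF z s p] nz] R2[OF far(2) osc[OF z s q] nz] by auto
      then have "K * (k\<^sup>2 * (f (z p))\<^sup>2 + (deriv f (z q))\<^sup>2)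
          \<le> K * (k\<^sup>2 * (e * \<bar>deriv f (z s)\<bar>) + e * \<bar>deriv f (z s)\<bar>)"
        using \<open>K > 0\<close> by (intro mult_left_mono add_mono) auto
      also have "\<dots> = K * (k\<^sup>2 + 1) * e * \<bar>deriv f (z s)\<bar>"
        by (simp add: algebra_simps)
      also have "\<dots> = \<bar>deriv f (z s)\<bar> / 2"
        unfolding Ke by simp
      finally show False
        using avg nz by simp
    qed
  qed
  moreover have "D > 0"
    using \<open>R2 > 0\<close> by (simp add: D_def)
  ultimately show ?thesis by blast
qed

end
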